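(* (SMDCT VII) Let $n,N$ be positive integers and $\rho=\left(\frac12,\dots,\frac12\right)\in\mathbb{R}^n$. For all $k,k'\in D_N^+$, $$\sum_{s\in F_N^{\mathrm{VII},+}}\varepsilon_s H_s^{-1}\cos_{k+\rho}^+(s)\cos_{k'+\rho}^+(s)=\frac{H_k}{\widetilde{d}_k}\left(\frac{2N-1}{4}\right)^n\delta_{kk'}.$$ Consequently any function $f:F_N^{\mathrm{VII},+}\to\mathbb{R}$ can be expanded, for all $s\in F_N^{\mathrm{VII},+}$, as $$f(s)=\sum_{k\in D_N^+}A_k\cos^+_{k+\rho}(s)\quad\text{with}\quad A_k=\frac{\widetilde{d}_k}{H_k}\left(\frac{4}{2N-1}\right)^n\sum_{s\in F_N^{\mathrm{VII},+}}\varepsilon_s H_s^{-1}f(s)\cos_{k+\rho}^+(s).$$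
   Context: For $\lambda,x\in\mathbb{R}^n$, the symmetric cosine function is $\cos^+_\lambda(x)=\sum_{\sigma\in S_n}\prod_{i=1}^n\cos(\pi\lambda_{\sigma(i)}x_i)$. For $y\in\mathbb{R}^n$, $H_y=\#\{\sigma\in S_n : \sigma(y)=y\}$ is the order of the stabilizer of $y$, where $\sigma(y)=(y_{\sigma(1)},\dots,y_{\sigma(n)})$. For fixed $N$, put $c_r=\frac12$ if $r=0$ or $r=N$, and $c_r=1$ otherwise. Let $D_N=\{(k_1,\dots,k_n)\in\mathbb{Z}^n : 0\le k_i\le N-1,\ i=1,\dots,n\}$ and $D_N^+=\{k\in D_N : k_1\ge k_2\ge\dots\ge k_n\}$. For $k\in D_N$, $\widetilde{d}_k=c_{k_1+1}\cdots c_{k_n+1}$. The grid is $F_N^{\mathrm{VII},+}=\left\{\left(\frac{2r_1}{2N-1},\dots,\frac{2r_n}{2N-1}\right) : (r_1,\dots,r_n)\in D_N^+\right\}$, and for $s=\left(\frac{2r_1}{2N-1},\dots,\frac{2r_n}{2N-1}\right)$ in it, $\varepsilon_s=c_{r_1}\cdots c_{r_n}$. *)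

theory Defs
  imports "HOL-Analysis.Analysis"
begin

text \<open>
  Vectors in n-space are indexed by a finite linearly ordered type \<open>'n\<close> with \<open>CARD('n) = n\<close>; the
  linear order on \<open>'n\<close> plays the role of the order of the coordinates \<open>1, \<dots>, n\<close>, and the
  symmetric group is \<open>{\<sigma>. \<sigma> permutes UNIV}\<close>.
\<close>

definition sym_cos :: "real ^ 'n \<Rightarrow> real ^ 'n::finite \<Rightarrow> real" where
  "sym_cos l x = (\<Sum>\<sigma> | \<sigma> permutes (UNIV :: 'n set). \<Prod>i\<in>UNIV. cos (pi * l $ \<sigma> i * x $ i))"

text \<open>Polymorphic in the entries, because it is used for both real points and integer labels.\<close>
definition stab_order :: "'a ^ 'n::finite \<Rightarrow> nat" where
  "stab_order y = card {\<sigma>. \<sigma> permutes (UNIV :: 'n set) \<and> (\<chi> i. y $ \<sigma> i) = y}"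

definition c_weight :: "nat \<Rightarrow> int \<Rightarrow> real" where
  "c_weight N r = (if r = 0 \<or> r = int N then 1/2 else 1)"

definition D_box :: "nat \<Rightarrow> (int ^ 'n::finite) set" where
  "D_box N = {k. \<forall>i. 0 \<le> k $ i \<and> k $ i \<le> int N - 1}"

definition D_plus :: "nat \<Rightarrow> (int ^ 'n::{finite,linorder}) set" where
  "D_plus N = {k \<in> D_box N. \<forall>i j. i \<le> j \<longrightarrow> k $ i \<ge> k $ j}"

definition d_tilde :: "nat \<Rightarrow> int ^ 'n::finite \<Rightarrow> real" where
  "d_tilde N k = (\<Prod>i\<in>UNIV. c_weight N (k $ i + 1))"

definition vec_of_int :: "int ^ 'n::finite \<Rightarrow> real ^ 'n" where
  "vec_of_int k = (\<chi> i. real_of_int (k $ i))"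

definition grid_point :: "nat \<Rightarrow> int ^ 'n::finite \<Rightarrow> real ^ 'n" where
  "grid_point N r = (\<chi> i. 2 * real_of_int (r $ i) / (2 * real N - 1))"

definition F_grid :: "nat \<Rightarrow> (real ^ 'n::{finite,linorder}) set" where
  "F_grid N = grid_point N ` D_plus N"

text \<open>The label of a grid point is unique, see \<open>grid_eps_grid_point\<close> below.\<close>
definition grid_eps :: "nat \<Rightarrow> real ^ 'n::{finite,linorder} \<Rightarrow> real" where
  "grid_eps N s = (\<Prod>i\<in>UNIV. c_weight N ((THE r. r \<in> D_plus N \<and> s = grid_point N r) $ i))"

lemma inj_grid_point: "inj (grid_point N)"
proof (rule injI)
  fix r r' :: "int ^ 'n"
  assume eq: "grid_point N r = grid_point N r'"
  have "2 * real N - 1 \<noteq> 0"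
  proof
    assume "2 * real N - 1 = 0"
    then have "real (2 * N) = real 1" by simp
    then have "2 * N = 1" by (simp only: of_nat_eq_iff)
    then show False by presburger
  qed
  with eq show "r = r'" by (simp add: grid_point_def vec_eq_iff)
qed

lemma grid_eps_grid_point:
  assumes "r \<in> D_plus N"
  shows "grid_eps N (grid_point N r) = (\<Prod>i\<in>UNIV. c_weight N (r $ i))"
proof -
  have "(THE q. q \<in> D_plus N \<and> grid_point N r = grid_point N q) = r"
    using assms inj_grid_point by (intro the_equality) (auto dest: injD)
  then show ?thesis by (simp add: grid_eps_def)
qed

end

theory Submission imports Defs begin

text \<open>
  On the grid the symmetric cosine is a permanent: with
  \<open>K a x = cos (\<pi> (a + 1/2) \<cdot> 2x / (2N - 1))\<close> its value is
  \<open>\<Sum>\<^sub>\<sigma> \<Prod>\<^sub>i K (k $ \<sigma> i) (r $ i)\<close>, a symmetric function of \<open>k\<close> and of \<open>r\<close>. Dividing by stabilizer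
  orders turns a sum over sorted labels into \<open>1/n!\<close> times the sum over the whole box (every label
  has exactly one sorted rearrangement, reached by as many permutations as its stabilizer has
  elements: \<open>sum_D_plus_orbits\<close>). Over the box, a product of two permanents is a double sum
  over permutations of products of one-dimensional sums. By one-dimensional orthogonality only
  pairs \<open>(\<sigma>, \<tau>)\<close> that make the two rearranged labels equal survive, which forces \<open>k = k'\<close> and
  leaves \<open>n! \<cdot> stab_order k\<close> pairs (\<open>sym_kernel_orthogonality\<close>).

  The one-dimensional orthogonality follows from the substitution \<open>a = N - 1 - m\<close>, which turns
  \<open>K a x\<close> into \<open>(-1)\<^sup>x cos (2\<pi> m x / (2N - 1))\<close> and the weight \<open>c_weight N (a + 1)\<close>
  into \<open>c_weight N m\<close>. Up to
  the sign this matrix is symmetric in \<open>m\<close> and \<open>x\<close>, so one computation with the Dirichlet kernel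
  gives the orthogonality of its rows and of its columns.

  Column orthogonality yields the expansion: inserting the definition of \<open>A\<close> and exchanging the
  sums leaves a sum over \<open>k\<close>, to which the same theorem on permanents applies with the transposed
  kernel.
\<close>

section \<open>Permuting coordinates\<close>

abbreviation permute_vec :: "('n \<Rightarrow> 'n) \<Rightarrow> 'a ^ 'n \<Rightarrow> 'a ^ 'n::finite" where
  "permute_vec \<sigma> y \<equiv> (\<chi> i. y $ \<sigma> i)"

lemma stab_order_pos: "stab_order (y :: 'a ^ 'n::finite) > 0"
proof -
  have "id \<in> {\<sigma>. \<sigma> permutes (UNIV :: 'n set) \<and> permute_vec \<sigma> y = y}"
    by (simp add: permutes_id)
  moreover have "finite {\<sigma>. \<sigma> permutes (UNIV :: 'n set) \<and> permute_vec \<sigma> y = y}"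
    by (rule finite_subset[OF _ finite_permutations[of UNIV]]) auto
  ultimately show ?thesis
    unfolding stab_order_def card_gt_0_iff by blast
qed

text \<open>
  The permutations that rearrange \<open>k\<close> in the same way as \<open>\<sigma>\<close> form a coset of the stabilizer of \<open>k\<close>.
\<close>

lemma card_same_permuted:
  fixes k :: "'a ^ 'n::finite"
  assumes \<sigma>: "\<sigma> permutes UNIV"
  shows "card {\<tau>. \<tau> permutes (UNIV :: 'n set) \<and> permute_vec \<tau> k = permute_vec \<sigma> k} = stab_order k"
  unfolding stab_order_def
proof (rule bij_betw_same_card[of "\<lambda>\<tau>. \<tau> \<circ> inv \<sigma>"], rule bij_betwI[where g = "\<lambda>\<tau>. \<tau> \<circ> \<sigma>"])
  have inv: "\<sigma> (inv \<sigma> i) = i" "inv \<sigma> (\<sigma> i) = i" for i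
    using permutes_inverses[OF \<sigma>] by auto
  show "(\<lambda>\<tau>. \<tau> \<circ> inv \<sigma>) \<in> {\<tau>. \<tau> permutes UNIV \<and> permute_vec \<tau> k = permute_vec \<sigma> k}
      \<rightarrow> {\<tau>. \<tau> permutes UNIV \<and> permute_vec \<tau> k = k}"
    using \<sigma> by (auto simp: vec_eq_iff inv intro: permutes_compose permutes_inv)
  show "(\<lambda>\<tau>. \<tau> \<circ> \<sigma>) \<in> {\<tau>. \<tau> permutes UNIV \<and> permute_vec \<tau> k = k}
      \<rightarrow> {\<tau>. \<tau> permutes UNIV \<and> permute_vec \<tau> k = permute_vec \<sigma> k}"
    using \<sigma> by (auto simp: vec_eq_iff intro: permutes_compose)
qed (auto simp: fun_eq_iff permutes_inverses[OF \<sigma>])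

lemma finite_D_box: "finite (D_box N :: (int ^ 'n::finite) set)"
proof (rule finite_subset)
  show "(D_box N :: (int ^ 'n) set) \<subseteq> vec_lambda ` (PiE UNIV (\<lambda>_. {0..int N - 1}))"
  proof
    fix k :: "int ^ 'n" assume "k \<in> D_box N"
    then have "vec_nth k \<in> PiE UNIV (\<lambda>_. {0..int N - 1})" by (auto simp: D_box_def)
    then have "vec_lambda (vec_nth k) \<in> vec_lambda ` (PiE UNIV (\<lambda>_. {0..int N - 1}))" by (rule imageI)
    then show "k \<in> vec_lambda ` (PiE UNIV (\<lambda>_. {0..int N - 1}))" by simp
  qed
qed (simp add: finite_PiE)

lemma D_plus_subset: "D_plus N \<subseteq> D_box N"
  by (auto simp: D_plus_def)

lemma finite_D_plus: "finite (D_plus N :: (int ^ 'n::{finite,linorder}) set)"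
  using finite_subset[OF D_plus_subset finite_D_box] .

lemma permute_vec_D_box: "k \<in> D_box N \<Longrightarrow> permute_vec \<sigma> k \<in> D_box N"
  by (auto simp: D_box_def)

lemma prod_sum_D_box:
  fixes f :: "'n::finite \<Rightarrow> int \<Rightarrow> real"
  shows "(\<Sum>r\<in>D_box N. \<Prod>i\<in>UNIV. f i (r $ i)) = (\<Prod>i\<in>UNIV. \<Sum>x\<in>{0..int N - 1}. f i x)"
proof -
  have "(\<Prod>i\<in>UNIV. \<Sum>x\<in>{0..int N - 1}. f i x)
      = (\<Sum>g\<in>PiE UNIV (\<lambda>_. {0..int N - 1}). \<Prod>i\<in>UNIV. f i (g i))"
    by (rule prod_sum_PiE) auto
  also have "\<dots> = (\<Sum>r\<in>D_box N. \<Prod>i\<in>UNIV. f i (r $ i))"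
    by (rule sum.reindex_bij_witness[of _ vec_nth vec_lambda])
      (auto simp: D_box_def)
  finally show ?thesis ..
qed

text \<open>
  A rearrangement has as many entries \<open>\<ge> c\<close> as the original. For \<open>c = r' $ i > r $ i\<close> sortedness would
  give \<open>r'\<close> at least the indices \<open>{..i}\<close> and \<open>r\<close> at most the indices \<open>{..<i}\<close>.
\<close>

lemma antitone_rearrangement_le:
  fixes r r' :: "int ^ 'n::{finite,linorder}"
  assumes r: "\<And>i j. i \<le> j \<Longrightarrow> r $ i \<ge> r $ j" and r': "\<And>i j. i \<le> j \<Longrightarrow> r' $ i \<ge> r' $ j"
    and \<sigma>: "\<sigma> permutes UNIV" and eq: "r' = permute_vec \<sigma> r"
  shows "r' $ i \<le> r $ i"
proof (rule ccontr)
  assume "\<not> r' $ i \<le> r $ i"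
  then have less: "r $ i < r' $ i" by simp
  have "\<sigma> ` {j. r' $ j \<ge> r' $ i} \<subseteq> {j. r $ j \<ge> r' $ i}"
    by (auto simp: eq)
  moreover have "inj_on \<sigma> {j. r' $ j \<ge> r' $ i}"
    using permutes_inj[OF \<sigma>] by (rule inj_on_subset) simp
  ultimately have "card {j. r' $ j \<ge> r' $ i} \<le> card {j. r $ j \<ge> r' $ i}"
    by (intro card_inj_on_le) auto
  also have "\<dots> \<le> card {..<i}"
  proof (rule card_mono)
    show "{j. r $ j \<ge> r' $ i} \<subseteq> {..<i}"
    proof
      fix j assume "j \<in> {j. r $ j \<ge> r' $ i}"
      then have "r $ i < r $ j" using less by simp
      then show "j \<in> {..<i}" using r[of i j] by (auto simp: not_less[symmetric])
    qed
  qed simp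
  also have "\<dots> < card {..i}"
    by (rule psubset_card_mono) auto
  also have "\<dots> \<le> card {j. r' $ j \<ge> r' $ i}"
    by (rule card_mono) (auto intro: r')
  finally show False by simp
qed

lemma D_plus_rearrangement_unique:
  fixes r r' :: "int ^ 'n::{finite,linorder}"
  assumes r: "r \<in> D_plus N" and r': "r' \<in> D_plus N"
    and \<sigma>: "\<sigma> permutes UNIV" and \<tau>: "\<tau> permutes UNIV"
    and eq: "permute_vec \<sigma> r = permute_vec \<tau> r'"
  shows "r = r'"
proof -
  have E: "r $ \<sigma> i = r' $ \<tau> i" for i
    using eq by (simp add: vec_eq_iff)
  have eqs: "r' = permute_vec (\<sigma> \<circ> inv \<tau>) r" "r = permute_vec (\<tau> \<circ> inv \<sigma>) r'"
    using E[of "inv \<tau> _"] E[of "inv \<sigma> _"]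
    by (simp_all add: vec_eq_iff permutes_inverses[OF \<tau>] permutes_inverses[OF \<sigma>])
  have perms: "\<sigma> \<circ> inv \<tau> permutes UNIV" "\<tau> \<circ> inv \<sigma> permutes UNIV"
    using \<sigma> \<tau> by (auto intro: permutes_compose permutes_inv)
  have anti: "i \<le> j \<Longrightarrow> r $ i \<ge> r $ j" "i \<le> j \<Longrightarrow> r' $ i \<ge> r' $ j" for i j
    using r r' by (simp_all add: D_plus_def)
  have "r' $ i \<le> r $ i" "r $ i \<le> r' $ i" for i
    by (rule antitone_rearrangement_le[OF anti perms(1) eqs(1)]
        antitone_rearrangement_le[OF anti(2,1) perms(2) eqs(2)]; assumption)+
  then show ?thesis by (simp add: vec_eq_iff order_antisym)
qed

text \<open>
  Sorting the list of all indices by descending entries gives the permutation; \<open>g\<close> in the proof is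
  the position of an index in the linear order of the index type.
\<close>

lemma exists_antitone_rearrangement:
  fixes y :: "'a::linordered_ab_group_add ^ 'n::{finite,linorder}"
  shows "\<exists>\<sigma>. \<sigma> permutes UNIV \<and> (\<forall>i j. i \<le> j \<longrightarrow> y $ \<sigma> i \<ge> y $ \<sigma> j)"
proof -
  define js where "js = sort_key (\<lambda>i. - y $ i) (sorted_list_of_set (UNIV :: 'n set))"
  define h where "h = nth (sorted_list_of_set (UNIV :: 'n set))"
  have h: "bij_betw h {..<CARD('n)} UNIV"
    unfolding h_def by (rule bij_betw_nth) auto
  have h_mono: "h i < h j" if "i < j" "j < CARD('n)" for i j
    using sorted_wrt_nth_less[OF strict_sorted_list_of_set[of "UNIV :: 'n set"]] that
    by (simp add: h_def)
  define g where "g = the_inv_into {..<CARD('n)} h"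
  have g: "bij_betw g UNIV {..<CARD('n)}"
    unfolding g_def using h by (rule bij_betw_the_inv_into)
  have hg: "h (g i) = i" for i
    unfolding g_def using h by (intro f_the_inv_into_f_bij_betw) auto
  have js: "set js = UNIV" "distinct js" "length js = CARD('n)"
    by (simp_all add: js_def)
  have "bij_betw (nth js) {..<CARD('n)} UNIV"
    using bij_betw_nth[of js "{..<CARD('n)}" UNIV] js by simp
  with g have "bij (nth js \<circ> g)" by (rule bij_betw_trans)
  then have perm: "nth js \<circ> g permutes UNIV" by (rule bij_imp_permutes) simp
  have "y $ (js ! g i) \<ge> y $ (js ! g j)" if "i \<le> j" for i j
  proof -
    have gi: "g i < CARD('n)" "g j < CARD('n)" for i j
      using g by (auto simp: bij_betw_def)
    have "g i \<le> g j"
    proof (rule ccontr)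
      assume "\<not> g i \<le> g j"
      then have "h (g j) < h (g i)" using h_mono gi by simp
      then show False using that by (simp add: hg)
    qed
    moreover have "sorted (map (\<lambda>i. - y $ i) js)"
      by (simp add: js_def)
    ultimately have "map (\<lambda>i. - y $ i) js ! g i \<le> map (\<lambda>i. - y $ i) js ! g j"
      using gi js by (intro sorted_nth_mono) auto
    then show ?thesis using gi js by simp
  qed
  with perm show ?thesis by auto
qed

text \<open>
  Both sides sum \<open>F\<close> over pairs of a sorted label \<open>r\<close> and a permutation, weighted with
  \<open>1 / stab_order r\<close>: a point \<open>y\<close> of the box is hit by one \<open>r\<close> only, and by a coset of the
  stabilizer of that \<open>r\<close>, hence with total weight \<open>1\<close>.
\<close>

lemma sum_D_plus_orbits:
  fixes F :: "int ^ 'n::{finite,linorder} \<Rightarrow> real"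
  assumes sym: "\<And>r \<sigma>. \<sigma> permutes UNIV \<Longrightarrow> F (permute_vec \<sigma> r) = F r"
  shows "fact CARD('n) * (\<Sum>r\<in>D_plus N. inverse (real (stab_order r)) * F r) = (\<Sum>y\<in>D_box N. F y)"
proof -
  define P where "P = {\<sigma>. \<sigma> permutes (UNIV :: 'n set)}"
  have fP: "finite P" by (simp add: P_def finite_permutations)
  have cP: "card P = fact CARD('n)" unfolding P_def by (rule card_permutations) auto
  have mult: "(\<Sum>r\<in>D_plus N. \<Sum>\<sigma>\<in>P. if permute_vec \<sigma> r = y then inverse (real (stab_order r)) else 0) = 1"
    if y: "y \<in> D_box N" for y :: "int ^ 'n::{finite,linorder}"
  proof -
    obtain \<tau> where \<tau>: "\<tau> permutes UNIV" "\<And>i j. i \<le> j \<Longrightarrow> y $ \<tau> i \<ge> y $ \<tau> j"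
      using exists_antitone_rearrangement[of y] by blast
    define q where "q = permute_vec \<tau> y"
    have q: "q \<in> D_plus N"
      using \<tau>(2) permute_vec_D_box[OF y, of \<tau>] by (auto simp: D_plus_def q_def)
    have yq: "y = permute_vec (inv \<tau>) q"
      by (simp add: q_def vec_eq_iff permutes_inverses[OF \<tau>(1)])
    have it: "inv \<tau> permutes UNIV" using \<tau>(1) by (rule permutes_inv)
    have "(\<Sum>\<sigma>\<in>P. if permute_vec \<sigma> r = y then inverse (real (stab_order r)) else 0)
        = (if r = q then 1 else 0)" if r: "r \<in> D_plus N" for r
    proof (cases "r = q")
      case True
      have "(\<Sum>\<sigma>\<in>P. if permute_vec \<sigma> q = y then inverse (real (stab_order q)) else 0)
          = real (card {\<sigma>\<in>P. permute_vec \<sigma> q = y}) * inverse (real (stab_order q))"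
        using fP by (simp add: sum.inter_filter[symmetric])
      also have "{\<sigma>\<in>P. permute_vec \<sigma> q = y}
          = {\<sigma>. \<sigma> permutes UNIV \<and> permute_vec \<sigma> q = permute_vec (inv \<tau>) q}"
        by (simp add: P_def yq)
      also have "card \<dots> = stab_order q" by (rule card_same_permuted[OF it])
      finally show ?thesis unfolding True using stab_order_pos[of q] by simp
    next
      case False
      then have "permute_vec \<sigma> r \<noteq> y" if "\<sigma> \<in> P" for \<sigma>
        using D_plus_rearrangement_unique[OF r q _ it] that yq by (auto simp: P_def)
      then show ?thesis using False by simp
    qed
    then have "(\<Sum>r\<in>D_plus N. \<Sum>\<sigma>\<in>P. if permute_vec \<sigma> r = y then inverse (real (stab_order r)) else 0)
        = (\<Sum>r\<in>D_plus N. if r = q then 1 else 0)"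
      by (intro sum.cong) auto
    then show ?thesis using q by (simp add: finite_D_plus)
  qed
  have "fact CARD('n) * (\<Sum>r\<in>D_plus N. inverse (real (stab_order r)) * F r)
      = (\<Sum>r\<in>D_plus N. \<Sum>\<sigma>\<in>P. inverse (real (stab_order r)) * F (permute_vec \<sigma> r))"
  proof -
    have "(\<Sum>\<sigma>\<in>P. inverse (real (stab_order r)) * F (permute_vec \<sigma> r))
        = (\<Sum>\<sigma>\<in>P. inverse (real (stab_order r)) * F r)" for r
      by (rule sum.cong[OF refl]) (simp only: P_def mem_Collect_eq sym)
    then show ?thesis by (simp add: cP sum_distrib_left)
  qed
  also have "\<dots> = (\<Sum>r\<in>D_plus N. \<Sum>\<sigma>\<in>P. \<Sum>y\<in>D_box N.
      (if permute_vec \<sigma> r = y then inverse (real (stab_order r)) else 0) * F y)"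
  proof (intro sum.cong refl)
    fix r :: "int ^ 'n::{finite,linorder}" and \<sigma> assume "r \<in> D_plus N"
    then have "permute_vec \<sigma> r \<in> D_box N" using D_plus_subset permute_vec_D_box by blast
    then show "inverse (real (stab_order r)) * F (permute_vec \<sigma> r) = (\<Sum>y\<in>D_box N.
        (if permute_vec \<sigma> r = y then inverse (real (stab_order r)) else 0) * F y)"
      by (simp add: finite_D_box if_distrib[of "\<lambda>x. x * _"] cong: if_cong)
  qed
  also have "\<dots> = (\<Sum>r\<in>D_plus N. \<Sum>y\<in>D_box N. \<Sum>\<sigma>\<in>P.
      (if permute_vec \<sigma> r = y then inverse (real (stab_order r)) else 0) * F y)"
    by (intro sum.cong refl sum.swap)
  also have "\<dots> = (\<Sum>y\<in>D_box N. (\<Sum>r\<in>D_plus N. \<Sum>\<sigma>\<in>P.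
      if permute_vec \<sigma> r = y then inverse (real (stab_order r)) else 0) * F y)"
    by (subst sum.swap) (simp add: sum_distrib_right)
  also have "\<dots> = (\<Sum>y\<in>D_box N. F y)"
    using mult by simp
  finally show ?thesis .
qed

section \<open>Symmetrised product kernels\<close>

text \<open>
  This is the permanent of the matrix with entries \<open>K (k $ i) (r $ j)\<close>.
\<close>

definition sym_kernel :: "(int \<Rightarrow> int \<Rightarrow> real) \<Rightarrow> int ^ 'n::finite \<Rightarrow> int ^ 'n \<Rightarrow> real" where
  "sym_kernel K k r = (\<Sum>\<sigma> | \<sigma> permutes (UNIV :: 'n set). \<Prod>i\<in>UNIV. K (k $ \<sigma> i) (r $ i))"

lemma sym_kernel_transpose: "sym_kernel K k r = sym_kernel (\<lambda>a b. K b a) r k"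
proof -
  have "sym_kernel K k r = (\<Sum>\<sigma> | \<sigma> permutes UNIV. \<Prod>i\<in>UNIV. K (k $ inv \<sigma> i) (r $ i))"
    unfolding sym_kernel_def by (rule sum_permutations_inverse)
  also have "\<dots> = (\<Sum>\<sigma> | \<sigma> permutes UNIV. \<Prod>i\<in>UNIV. K (k $ i) (r $ \<sigma> i))"
  proof (rule sum.cong[OF refl])
    fix \<sigma> :: "'a \<Rightarrow> 'a" assume "\<sigma> \<in> {\<sigma>. \<sigma> permutes UNIV}"
    then have \<sigma>: "\<sigma> permutes UNIV" by simp
    have "(\<Prod>i\<in>UNIV. K (k $ inv \<sigma> i) (r $ i)) = (\<Prod>i\<in>UNIV. K (k $ inv \<sigma> (\<sigma> i)) (r $ \<sigma> i))"
      using prod.permute[OF \<sigma>, of "\<lambda>i. K (k $ inv \<sigma> i) (r $ i)"] by (simp add: comp_def)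
    then show "(\<Prod>i\<in>UNIV. K (k $ inv \<sigma> i) (r $ i)) = (\<Prod>i\<in>UNIV. K (k $ i) (r $ \<sigma> i))"
      by (simp add: permutes_inverses[OF \<sigma>])
  qed
  finally show ?thesis by (simp add: sym_kernel_def)
qed

lemma sym_kernel_permute:
  fixes k r :: "int ^ 'n::finite"
  assumes \<sigma>: "\<sigma> permutes UNIV"
  shows "sym_kernel K (permute_vec \<sigma> k) r = sym_kernel K k r"
  unfolding sym_kernel_def
  using setum_permutations_compose_left[OF \<sigma>, of "\<lambda>\<tau>. \<Prod>i\<in>UNIV. K (k $ \<tau> i) (r $ i)"]
  by (simp add: comp_def)

text \<open>
  Stated for an arbitrary kernel, because it is applied once to the cosine kernel and once to its
  transpose, with the roles of the two weights \<open>w\<close> and \<open>v\<close> exchanged.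
\<close>

theorem sym_kernel_orthogonality:
  fixes k k' :: "int ^ 'n::{finite,linorder}"
  assumes orth: "\<And>a b. a \<in> {0..int N - 1} \<Longrightarrow> b \<in> {0..int N - 1} \<Longrightarrow>
      (\<Sum>x\<in>{0..int N - 1}. w x * K a x * K b x) = (if a = b then G / v a else 0)"
    and k: "k \<in> D_plus N" and k': "k' \<in> D_plus N"
  shows "(\<Sum>r\<in>D_plus N. (\<Prod>i\<in>UNIV. w (r $ i)) * inverse (real (stab_order r))
      * sym_kernel K k r * sym_kernel K k' r)
    = (if k = k' then real (stab_order k) * G ^ CARD('n) / (\<Prod>i\<in>UNIV. v (k $ i)) else 0)"
proof -
  define P where "P = {\<sigma>. \<sigma> permutes (UNIV :: 'n set)}"
  have fP: "finite P" by (simp add: P_def finite_permutations)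
  have cP: "card P = fact CARD('n)" unfolding P_def by (rule card_permutations) auto
  define c where "c = G ^ CARD('n) / (\<Prod>i\<in>UNIV. v (k $ i))"
  define F where "F r = (\<Prod>i\<in>UNIV. w (r $ i)) * (sym_kernel K k r * sym_kernel K k' r)" for r
  have box: "k $ i \<in> {0..int N - 1}" "k' $ i \<in> {0..int N - 1}" for i
    using k k' by (auto simp: D_plus_def D_box_def)
  \<comment> \<open>A single coordinate with two different labels annihilates the whole product.\<close>
  have factor: "(\<Prod>i\<in>UNIV. \<Sum>x\<in>{0..int N - 1}. w x * K (k $ \<sigma> i) x * K (k' $ \<tau> i) x)
      = (if permute_vec \<tau> k' = permute_vec \<sigma> k then c else 0)" if \<sigma>: "\<sigma> \<in> P" for \<sigma> \<tau>
  proof (cases "permute_vec \<tau> k' = permute_vec \<sigma> k")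
    case True
    then have "k' $ \<tau> i = k $ \<sigma> i" for i by (simp add: vec_eq_iff)
    then have "(\<Prod>i\<in>UNIV. \<Sum>x\<in>{0..int N - 1}. w x * K (k $ \<sigma> i) x * K (k' $ \<tau> i) x)
        = (\<Prod>i\<in>UNIV. G / v (k $ \<sigma> i))"
      using orth box by (intro prod.cong) auto
    also have "\<dots> = (\<Prod>i\<in>UNIV. G / v (k $ i))"
      using prod.permute[of \<sigma> UNIV "\<lambda>i. G / v (k $ i)"] \<sigma> by (simp add: comp_def P_def)
    also have "\<dots> = c" by (simp add: prod_dividef c_def)
    finally show ?thesis using True by simp
  next
    case False
    then obtain i where "k $ \<sigma> i \<noteq> k' $ \<tau> i" by (metis (mono_tags, lifting) vec_lambda_unique vec_lambda_beta vec_eq_iff)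
    then have "(\<Sum>x\<in>{0..int N - 1}. w x * K (k $ \<sigma> i) x * K (k' $ \<tau> i) x) = 0"
      using orth box by simp
    then show ?thesis using False by (subst prod_zero) auto
  qed
  have F_sym: "F (permute_vec \<sigma> r) = F r" if \<sigma>: "\<sigma> permutes UNIV" for \<sigma> r
  proof -
    have "sym_kernel K l (permute_vec \<sigma> r) = sym_kernel K l r" for l
      using sym_kernel_permute[OF \<sigma>, of "\<lambda>a b. K b a" r l] sym_kernel_transpose[of K l] by simp
    moreover have "(\<Prod>i\<in>UNIV. w (r $ \<sigma> i)) = (\<Prod>i\<in>UNIV. w (r $ i))"
      using prod.permute[OF \<sigma>, of "\<lambda>i. w (r $ i)"] by (simp add: comp_def)
    ultimately show ?thesis by (simp add: F_def)
  qed
  have "(\<Sum>r\<in>D_box N. F r) = (\<Sum>r\<in>D_box N. \<Sum>\<sigma>\<in>P. \<Sum>\<tau>\<in>P.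
      \<Prod>i\<in>UNIV. w (r $ i) * K (k $ \<sigma> i) (r $ i) * K (k' $ \<tau> i) (r $ i))"
    unfolding F_def sym_kernel_def P_def[symmetric] sum_product
    by (simp add: sum_distrib_left prod.distrib mult.assoc)
  also have "\<dots> = (\<Sum>\<sigma>\<in>P. \<Sum>r\<in>D_box N. \<Sum>\<tau>\<in>P.
      \<Prod>i\<in>UNIV. w (r $ i) * K (k $ \<sigma> i) (r $ i) * K (k' $ \<tau> i) (r $ i))"
    by (rule sum.swap)
  also have "\<dots> = (\<Sum>\<sigma>\<in>P. \<Sum>\<tau>\<in>P. \<Sum>r\<in>D_box N.
      \<Prod>i\<in>UNIV. w (r $ i) * K (k $ \<sigma> i) (r $ i) * K (k' $ \<tau> i) (r $ i))"
    by (intro sum.cong refl sum.swap)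
  also have "\<dots> = (\<Sum>\<sigma>\<in>P. \<Sum>\<tau>\<in>P. if permute_vec \<tau> k' = permute_vec \<sigma> k then c else 0)"
  proof (intro sum.cong refl)
    fix \<sigma> \<tau> assume "\<sigma> \<in> P"
    then show "(\<Sum>r\<in>D_box N. \<Prod>i\<in>UNIV. w (r $ i) * K (k $ \<sigma> i) (r $ i) * K (k' $ \<tau> i) (r $ i))
        = (if permute_vec \<tau> k' = permute_vec \<sigma> k then c else 0)"
      by (rule trans[OF prod_sum_D_box[of "\<lambda>i x. w x * K (k $ \<sigma> i) x * K (k' $ \<tau> i) x" N] factor])
  qed
  also have "\<dots> = (\<Sum>\<sigma>\<in>P. if k = k' then real (stab_order k) * c else 0)"
  proof (rule sum.cong[OF refl])
    fix \<sigma> assume \<sigma>: "\<sigma> \<in> P"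
    show "(\<Sum>\<tau>\<in>P. if permute_vec \<tau> k' = permute_vec \<sigma> k then c else 0)
        = (if k = k' then real (stab_order k) * c else 0)"
    proof (cases "k = k'")
      case True
      have "(\<Sum>\<tau>\<in>P. if permute_vec \<tau> k = permute_vec \<sigma> k then c else 0)
          = real (card {\<tau>\<in>P. permute_vec \<tau> k = permute_vec \<sigma> k}) * c"
        using fP by (simp add: sum.inter_filter[symmetric])
      then show ?thesis using True \<sigma> card_same_permuted[of \<sigma> k] by (simp add: P_def)
    next
      case False
      then have "permute_vec \<tau> k' \<noteq> permute_vec \<sigma> k" if "\<tau> \<in> P" for \<tau>
        using D_plus_rearrangement_unique[OF k k', of \<sigma> \<tau>] \<sigma> that unfolding P_def by force
      then show ?thesis using False by simp
    qed
  qed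
  also have "\<dots> = fact CARD('n) * (if k = k' then real (stab_order k) * c else 0)"
    by (simp add: cP)
  finally have "(\<Sum>r\<in>D_box N. F r) = fact CARD('n) * (if k = k' then real (stab_order k) * c else 0)" .
  then have "(\<Sum>r\<in>D_plus N. inverse (real (stab_order r)) * F r)
      = (if k = k' then real (stab_order k) * c else 0)"
    using sum_D_plus_orbits[of F N, OF F_sym] by simp
  moreover have "(\<Sum>r\<in>D_plus N. (\<Prod>i\<in>UNIV. w (r $ i)) * inverse (real (stab_order r))
      * sym_kernel K k r * sym_kernel K k' r) = (\<Sum>r\<in>D_plus N. inverse (real (stab_order r)) * F r)"
    by (intro sum.cong refl) (simp add: F_def mult_ac)
  ultimately show ?thesis by (simp add: c_def)
qed

section \<open>One-dimensional orthogonality\<close>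

lemma dirichlet_kernel:
  fixes x :: real
  shows "2 * sin (x / 2) * (\<Sum>r<Suc n. (if r = 0 then 1/2 else 1) * cos (real r * x))
    = sin ((real n + 1/2) * x)"
proof (induction n)
  case 0
  then show ?case by simp
next
  case (Suc n)
  have "2 * sin (x / 2) * cos (real (Suc n) * x)
      = sin ((real (Suc n) + 1/2) * x) - sin ((real n + 1/2) * x)"
    using sin_times_cos[of "x / 2" "real (Suc n) * x"] sin_minus[of "(real n + 1/2) * x"]
    by (simp add: algebra_simps add_divide_distrib)
  with Suc.IH show ?case by (simp add: algebra_simps)
qed

text \<open>
  The sum over the half period with weight \<open>1/2\<close> at \<open>0\<close> is half the sum over a full period
  \<open>{-(N-1)..N-1}\<close> of length \<open>2N - 1\<close>, a sum of powers of a root of unity.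
\<close>

lemma sum_half_period_cos:
  assumes N: "N \<ge> 1"
  shows "(\<Sum>r\<in>{0..int N - 1}. c_weight N r * cos (2 * pi * real_of_int t * real_of_int r / (2 * real N - 1)))
    = (if (2 * int N - 1) dvd t then (2 * real N - 1) / 2 else 0)"
proof -
  define M where "M = 2 * real N - 1"
  have M: "M > 0" using N by (simp add: M_def)
  define x where "x = 2 * pi * real_of_int t / M"
  obtain n where n: "N = Suc n" using N by (cases N) auto
  have "(\<Sum>r\<in>{0..int N - 1}. c_weight N r * cos (2 * pi * real_of_int t * real_of_int r / M))
      = (\<Sum>r<Suc n. (if r = 0 then 1/2 else 1) * cos (real r * x))" (is "_ = ?S")
    by (rule sum.reindex_bij_witness[of _ int nat])
      (auto simp: n c_weight_def x_def mult_ac)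
  moreover have "?S = (if (2 * int N - 1) dvd t then M / 2 else 0)"
  proof (cases "(2 * int N - 1) dvd t")
    case True
    then obtain q where "t = (2 * int N - 1) * q" by auto
    then have "x = 2 * pi * real_of_int q" using M by (simp add: x_def M_def)
    then have "cos (real r * x) = 1" for r
      using cos_int_2pin[of "int r * q"] by (simp add: mult_ac)
    then have "?S = (\<Sum>r<Suc n. if r = 0 then 1/2 else 1)" by simp
    also have "\<dots> = real n + 1/2"
      by (induction n) auto
    finally show ?thesis using True by (simp add: M_def n)
  next
    case False
    \<comment> \<open>In the closed form of the Dirichlet kernel the right-hand side is \<open>sin (t \<pi>) = 0\<close>.\<close>
    have "sin (x / 2) \<noteq> 0"
    proof
      assume "sin (x / 2) = 0"
      then obtain i where "x / 2 = real_of_int i * pi" by (auto simp: sin_zero_iff_int2)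
      then have "real_of_int t = M * real_of_int i" using M by (simp add: x_def field_simps)
      then have "real_of_int t = real_of_int ((2 * int N - 1) * i)" by (simp add: M_def)
      then show False using False by (simp only: of_int_eq_iff) simp
    qed
    moreover have "(real n + 1/2) * x = real_of_int t * pi"
      using M by (simp add: x_def M_def n field_simps)
    then have "sin ((real n + 1/2) * x) = 0"
      by (simp only: sin_zero_iff_int2) blast
    ultimately show ?thesis using dirichlet_kernel[of x n] False by simp
  qed
  ultimately show ?thesis by (simp add: M_def)
qed

text \<open>
  By the product formula for cosines, only the frequencies \<open>a - b\<close> and \<open>a + b\<close> matter. They are too
  small to be nonzero multiples of \<open>2N - 1\<close>; the second one vanishes only for \<open>a = b = 0\<close>, which
  accounts for the weight at \<open>0\<close>.
\<close>

lemma cos_half_period_orthogonality: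
  assumes N: "N \<ge> 1" and a: "a \<in> {0..int N - 1}" and b: "b \<in> {0..int N - 1}"
  shows "(\<Sum>x\<in>{0..int N - 1}. c_weight N x
      * cos (2 * pi * real_of_int a * real_of_int x / (2 * real N - 1))
      * cos (2 * pi * real_of_int b * real_of_int x / (2 * real N - 1)))
    = (if a = b then (2 * real N - 1) / 4 / c_weight N a else 0)"
proof -
  define E where "E t x = cos (2 * pi * real_of_int t * real_of_int x / (2 * real N - 1))" for t x
  have prod: "E a x * E b x = (E (a - b) x + E (a + b) x) / 2" for x
    unfolding E_def by (subst cos_times_cos) (simp add: algebra_simps diff_divide_distrib add_divide_distrib)
  have "(\<Sum>x\<in>{0..int N - 1}. c_weight N x * E a x * E b x)
      = ((\<Sum>x\<in>{0..int N - 1}. c_weight N x * E (a - b) x)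
        + (\<Sum>x\<in>{0..int N - 1}. c_weight N x * E (a + b) x)) / 2"
    by (simp add: prod mult.assoc sum.distrib[symmetric] sum_divide_distrib distrib_left)
  also have "\<dots> = ((if (2 * int N - 1) dvd (a - b) then (2 * real N - 1) / 2 else 0)
      + (if (2 * int N - 1) dvd (a + b) then (2 * real N - 1) / 2 else 0)) / 2"
    unfolding E_def sum_half_period_cos[OF N] ..
  also have "(2 * int N - 1) dvd (a - b) \<longleftrightarrow> a = b"
  proof
    assume "(2 * int N - 1) dvd (a - b)"
    moreover have "\<bar>a - b\<bar> < \<bar>2 * int N - 1\<bar>" using a b by auto
    ultimately show "a = b" using dvd_imp_le_int[of "a - b" "2 * int N - 1"] by linarith
  qed simp
  also have "(2 * int N - 1) dvd (a + b) \<longleftrightarrow> a = 0 \<and> b = 0"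
  proof
    assume "(2 * int N - 1) dvd (a + b)"
    moreover have "a + b < 2 * int N - 1" "a \<ge> 0" "b \<ge> 0" using a b by auto
    ultimately show "a = 0 \<and> b = 0" using zdvd_imp_le[of "2 * int N - 1" "a + b"] by linarith
  qed simp
  finally show ?thesis
    unfolding E_def using a by (auto simp: c_weight_def)
qed

definition dct7_kernel :: "nat \<Rightarrow> int \<Rightarrow> int \<Rightarrow> real" where
  "dct7_kernel N a x = cos (pi * (real_of_int a + 1/2) * (2 * real_of_int x / (2 * real N - 1)))"

text \<open>
  Since \<open>2a + 1 = (2N - 1) - 2(N - 1 - a)\<close>, the kernel is a signed cosine of integral frequency.
\<close>

lemma dct7_kernel_reflect:
  assumes "N \<ge> 1"
  shows "dct7_kernel N a x = cos (pi * real_of_int x)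
    * cos (2 * pi * real_of_int (int N - 1 - a) * real_of_int x / (2 * real N - 1))"
proof -
  have "2 * real N - 1 \<noteq> 0" using assms by simp
  then have "pi * (real_of_int a + 1/2) * (2 * real_of_int x / (2 * real N - 1))
      = pi * real_of_int x - 2 * pi * real_of_int (int N - 1 - a) * real_of_int x / (2 * real N - 1)"
    by (simp add: field_simps)
  moreover have "sin (pi * real_of_int x) = 0"
    by (simp add: sin_zero_iff_int2 mult.commute)
  ultimately show ?thesis unfolding dct7_kernel_def by (simp add: cos_diff)
qed

lemma cos_pi_int_square: "cos (pi * real_of_int x) * cos (pi * real_of_int x) = 1"
  using sin_cos_squared_add[of "pi * real_of_int x"] sin_zero_iff_int2[of "pi * real_of_int x"]
  by (auto simp: power2_eq_square mult.commute)

lemma dct7_orthogonality: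
  assumes N: "N \<ge> 1" and a: "a \<in> {0..int N - 1}" and b: "b \<in> {0..int N - 1}"
  shows "(\<Sum>x\<in>{0..int N - 1}. c_weight N x * dct7_kernel N a x * dct7_kernel N b x)
    = (if a = b then (2 * real N - 1) / 4 / c_weight N (a + 1) else 0)"
proof -
  have "(\<Sum>x\<in>{0..int N - 1}. c_weight N x * dct7_kernel N a x * dct7_kernel N b x)
     = (\<Sum>x\<in>{0..int N - 1}. c_weight N x
      * cos (2 * pi * real_of_int (int N - 1 - a) * real_of_int x / (2 * real N - 1))
      * cos (2 * pi * real_of_int (int N - 1 - b) * real_of_int x / (2 * real N - 1)))"
  proof (rule sum.cong[OF refl])
    fix x
    have sq: "c * (s * p) * (s * q) = (s * s) * (c * p * q)" for c s p q :: real by simp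
    show "c_weight N x * dct7_kernel N a x * dct7_kernel N b x = c_weight N x
      * cos (2 * pi * real_of_int (int N - 1 - a) * real_of_int x / (2 * real N - 1))
      * cos (2 * pi * real_of_int (int N - 1 - b) * real_of_int x / (2 * real N - 1))"
      unfolding dct7_kernel_reflect[OF N] sq cos_pi_int_square by simp
  qed
  also have "\<dots> = (if a = b then (2 * real N - 1) / 4 / c_weight N (int N - 1 - a) else 0)"
    using a b by (subst cos_half_period_orthogonality[OF N]) auto
  also have "c_weight N (int N - 1 - a) = c_weight N (a + 1)"
    using a by (auto simp: c_weight_def)
  finally show ?thesis .
qed

lemma dct7_dual_orthogonality:
  assumes N: "N \<ge> 1" and x: "x \<in> {0..int N - 1}" and y: "y \<in> {0..int N - 1}"
  shows "(\<Sum>a\<in>{0..int N - 1}. c_weight N (a + 1) * dct7_kernel N a x * dct7_kernel N a y)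
    = (if x = y then (2 * real N - 1) / 4 / c_weight N x else 0)"
proof -
  have "(\<Sum>a\<in>{0..int N - 1}. c_weight N (a + 1) * dct7_kernel N a x * dct7_kernel N a y)
     = (\<Sum>m\<in>{0..int N - 1}. cos (pi * real_of_int x) * cos (pi * real_of_int y) * (c_weight N m
      * cos (2 * pi * real_of_int x * real_of_int m / (2 * real N - 1))
      * cos (2 * pi * real_of_int y * real_of_int m / (2 * real N - 1))))"
    by (rule sum.reindex_bij_witness[of _ "\<lambda>m. int N - 1 - m" "\<lambda>a. int N - 1 - a"])
      (auto simp: dct7_kernel_reflect[OF N] c_weight_def mult_ac)
  also have "\<dots> = cos (pi * real_of_int x) * cos (pi * real_of_int y)
      * (if x = y then (2 * real N - 1) / 4 / c_weight N x else 0)"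
    unfolding sum_distrib_left[symmetric] cos_half_period_orthogonality[OF N x y] ..
  also have "\<dots> = (if x = y then (2 * real N - 1) / 4 / c_weight N x else 0)"
    by (simp add: cos_pi_int_square)
  finally show ?thesis .
qed

section \<open>The symmetric transform of type VII\<close>

lemma sym_cos_grid_point:
  "sym_cos (vec_of_int k + (\<chi> i. 1/2)) (grid_point N r) = sym_kernel (dct7_kernel N) k r"
  by (simp add: sym_cos_def sym_kernel_def dct7_kernel_def vec_of_int_def grid_point_def)

lemma stab_order_grid_point: "stab_order (grid_point N r) = stab_order r"
proof -
  have "permute_vec \<sigma> (grid_point N r) = grid_point N (permute_vec \<sigma> r)" for \<sigma>
    by (simp add: grid_point_def vec_eq_iff)
  then show ?thesis
    unfolding stab_order_def by (simp add: inj_eq[OF inj_grid_point])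
qed

lemma sum_F_grid:
  fixes g :: "real ^ 'n::{finite,linorder} \<Rightarrow> real"
  shows "(\<Sum>s\<in>F_grid N. g s) = (\<Sum>r\<in>D_plus N. g (grid_point N r))"
  unfolding F_grid_def
  by (subst sum.reindex) (auto intro: inj_on_subset[OF inj_grid_point])

theorem mainTheorem7:
  fixes N :: nat and \<rho> :: "real ^ 'n::{finite,linorder}"
  assumes "N \<ge> 1" and "\<rho> = (\<chi> i. 1/2)"
  shows
    "(\<forall>k \<in> D_plus N. \<forall>k' \<in> D_plus N.
        (\<Sum>s\<in>F_grid N. grid_eps N s * inverse (real (stab_order s)) *
            sym_cos (vec_of_int k + \<rho>) s * sym_cos (vec_of_int k' + \<rho>) s)
        = real (stab_order k) / d_tilde N k * ((2 * real N - 1) / 4) ^ CARD('n) *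
            (if k = k' then 1 else 0)) \<and>
     (\<forall>(f :: real ^ 'n::{finite,linorder} \<Rightarrow> real) (A :: int ^ 'n::{finite,linorder} \<Rightarrow> real).
        (\<forall>k \<in> D_plus N.
           A k = d_tilde N k / real (stab_order k) * (4 / (2 * real N - 1)) ^ CARD('n) *
             (\<Sum>s\<in>F_grid N. grid_eps N s * inverse (real (stab_order s)) * f s *
                sym_cos (vec_of_int k + \<rho>) s)) \<longrightarrow>
        (\<forall>s \<in> F_grid N. f s = (\<Sum>k\<in>D_plus N. A k * sym_cos (vec_of_int k + \<rho>) s)))"
proof (intro conjI ballI allI impI)
  define G where "G = (2 * real N - 1) / 4"
  define S where "S = (sym_kernel (dct7_kernel N) :: int ^ 'n::{finite,linorder} \<Rightarrow> int ^ 'n::{finite,linorder} \<Rightarrow> real)"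
  define W where "W r = (\<Prod>i\<in>UNIV. c_weight N (r $ i))" for r :: "int ^ 'n::{finite,linorder}"
  have sym_cos_S: "sym_cos (vec_of_int k + \<rho>) (grid_point N r) = S k r" for k r
    by (simp add: assms(2) sym_cos_grid_point S_def)
  have sum_grid: "(\<Sum>s\<in>F_grid N. grid_eps N s * inverse (real (stab_order s)) * h s)
      = (\<Sum>r\<in>D_plus N. W r * inverse (real (stab_order r)) * h (grid_point N r))"
    for h :: "real ^ 'n::{finite,linorder} \<Rightarrow> real"
    unfolding sum_F_grid
    by (intro sum.cong refl) (simp add: grid_eps_grid_point stab_order_grid_point W_def)
  {
    fix k k' :: "int ^ 'n::{finite,linorder}"
    assume k: "k \<in> D_plus N" and k': "k' \<in> D_plus N"
    have "(\<Sum>s\<in>F_grid N. grid_eps N s * inverse (real (stab_order s)) *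
            sym_cos (vec_of_int k + \<rho>) s * sym_cos (vec_of_int k' + \<rho>) s)
        = (\<Sum>r\<in>D_plus N. W r * inverse (real (stab_order r)) * S k r * S k' r)"
      using sum_grid[of "\<lambda>s. sym_cos (vec_of_int k + \<rho>) s * sym_cos (vec_of_int k' + \<rho>) s"]
      by (simp add: sym_cos_S mult.assoc)
    also have "\<dots> = (if k = k' then real (stab_order k) * G ^ CARD('n) / d_tilde N k else 0)"
      unfolding W_def S_def d_tilde_def
      by (rule sym_kernel_orthogonality[OF _ k k', where v = "\<lambda>a. c_weight N (a + 1)"])
        (simp only: dct7_orthogonality[OF assms(1)] G_def)
    finally show "(\<Sum>s\<in>F_grid N. grid_eps N s * inverse (real (stab_order s)) *
            sym_cos (vec_of_int k + \<rho>) s * sym_cos (vec_of_int k' + \<rho>) s)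
        = real (stab_order k) / d_tilde N k * ((2 * real N - 1) / 4) ^ CARD('n) *
            (if k = k' then 1 else 0)"
      by (simp add: G_def)
  next
    fix f :: "real ^ 'n::{finite,linorder} \<Rightarrow> real" and A :: "int ^ 'n::{finite,linorder} \<Rightarrow> real" and s :: "real ^ 'n::{finite,linorder}"
    assume A: "\<forall>k \<in> D_plus N.
           A k = d_tilde N k / real (stab_order k) * (4 / (2 * real N - 1)) ^ CARD('n) *
             (\<Sum>s\<in>F_grid N. grid_eps N s * inverse (real (stab_order s)) * f s *
                sym_cos (vec_of_int k + \<rho>) s)"
      and "s \<in> F_grid N"
    then obtain q where q: "q \<in> D_plus N" "s = grid_point N q" by (auto simp: F_grid_def)
    define B where "B r = W r * inverse (real (stab_order r)) * f (grid_point N r)" for r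
    have G: "G \<noteq> 0" using assms(1) by (simp add: G_def)
    have W: "W r \<noteq> 0" for r by (simp add: W_def c_weight_def)
    \<comment> \<open>The same orthogonality with labels and grid points exchanged.\<close>
    have dual: "(\<Sum>k\<in>D_plus N. d_tilde N k * inverse (real (stab_order k)) * S k r * S k q)
        = (if r = q then real (stab_order r) * G ^ CARD('n) / W r else 0)" if r: "r \<in> D_plus N" for r
      unfolding W_def S_def d_tilde_def
        sym_kernel_transpose[of "dct7_kernel N" _ r] sym_kernel_transpose[of "dct7_kernel N" _ q]
      by (rule sym_kernel_orthogonality[OF _ r q(1), where w = "\<lambda>a. c_weight N (a + 1)"])
        (simp only: dct7_dual_orthogonality[OF assms(1)] G_def)
    have coeff: "A k = d_tilde N k * inverse (real (stab_order k)) * inverse (G ^ CARD('n))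
        * (\<Sum>r\<in>D_plus N. B r * S k r)" if "k \<in> D_plus N" for k
      using A that sum_grid[of "\<lambda>s. f s * sym_cos (vec_of_int k + \<rho>) s"]
      by (simp add: sym_cos_S mult.assoc B_def G_def power_divide inverse_eq_divide)
    have "(\<Sum>k\<in>D_plus N. A k * sym_cos (vec_of_int k + \<rho>) s)
        = (\<Sum>k\<in>D_plus N. \<Sum>r\<in>D_plus N. inverse (G ^ CARD('n)) * B r
            * (d_tilde N k * inverse (real (stab_order k)) * S k r * S k q))"
      by (intro sum.cong refl)
        (simp add: coeff q(2) sym_cos_S sum_distrib_left sum_distrib_right mult_ac)
    also have "\<dots> = (\<Sum>r\<in>D_plus N. inverse (G ^ CARD('n)) * B r
            * (\<Sum>k\<in>D_plus N. d_tilde N k * inverse (real (stab_order k)) * S k r * S k q))"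
      by (subst sum.swap) (simp add: sum_distrib_left)
    also have "\<dots> = (\<Sum>r\<in>D_plus N. if r = q then inverse (G ^ CARD('n)) * B q
            * (real (stab_order q) * G ^ CARD('n) / W q) else 0)"
      by (intro sum.cong refl) (simp add: dual)
    also have "\<dots> = inverse (G ^ CARD('n)) * B q * (real (stab_order q) * G ^ CARD('n) / W q)"
      using q(1) by (simp add: finite_D_plus)
    also have "\<dots> = f s"
      using G W[of q] stab_order_pos[of q] by (simp add: B_def q(2) field_simps)
    finally show "f s = (\<Sum>k\<in>D_plus N. A k * sym_cos (vec_of_int k + \<rho>) s)" ..
  }
qed

end
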